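(* The iterational depth of the wreath product $\mathbb{Z}\wr\mathbb{Z}$ is $s(\mathbb{Z}\wr\mathbb{Z})=2$.
   Context: $\mathbb{Z}\wr\mathbb{Z}$ denotes the restricted wreath product, i.e. the semidirect product of $\bigoplus_{i\in\mathbb{Z}}\mathbb{Z}$ with $\mathbb{Z}$, where $\mathbb{Z}$ acts by shifting coordinates. Let $w=w(x_1,\dots,x_n)$ be a word (element of the free group $F_n$ on $x_1,\dots,x_n$, $n\ge 1$). Its Engel type iterations on the first variable are $w_{\circ 1}=w$ and $w_{\circ (N+1)}(x_1,\dots,x_n)=w(w_{\circ N}(x_1,\dots,x_n),x_2,\dots,x_n)$ for $N\ge 1$. A group $G$ satisfies the ($E$-type) iterated identity $w$ if for all $x_1,\dots,x_n\in G$ there exists $N\ge 1$ with $w_{\circ N}(x_1,\dots,x_n)=e$ in $G$. If $w$ is an iterated identity of $G$, the iterational depth $s(w,G)$ of $w$ in $G$ is the infimum (possibly $+\infty$) of those integers $D\ge 1$ such that for all $x_1,\dots,x_n\in G$ there is $1\le d\le D$ with $w_{\circ d}(x_1,\dots,x_n)=e$. A word is non-trivial if it is not equal to the identity in the free group. The iterational depth of $G$ is $s(G)=\sup_w s(w,G)$, the supremum over all non-trivial iterated identities $w$ (in any number of variables) satisfied by $G$; if $G$ satisfies no non-trivial iterated identity, $s(G)=-\infty$. *)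

theory Defs
  imports "HOL-Algebra.Elementary_Groups" "HOL-Algebra.Product_Groups" "HOL-Library.Extended_Real"
begin

section \<open>Free groups, realised on reduced words\<close>

text \<open>
  A letter \<open>(i, True)\<close> stands for the generator \<open>x\<^sub>i\<close> and \<open>(i, False)\<close> for its inverse.
\<close>

definition inv_letter :: "'x \<times> bool \<Rightarrow> 'x \<times> bool"
  where "inv_letter a = (fst a, \<not> snd a)"

definition reduced :: "('x \<times> bool) list \<Rightarrow> bool"
  where "reduced u \<longleftrightarrow> successively (\<lambda>a b. b \<noteq> inv_letter a) u"

fun red_cons :: "'x \<times> bool \<Rightarrow> ('x \<times> bool) list \<Rightarrow> ('x \<times> bool) list"
  where
    "red_cons a [] = [a]"
  | "red_cons a (b # u) = (if b = inv_letter a then u else a # b # u)"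

definition free_group :: "'x set \<Rightarrow> ('x \<times> bool) list monoid"
  where "free_group X =
    \<lparr>carrier = {u. reduced u \<and> fst ` set u \<subseteq> X},
     monoid.mult = (\<lambda>u v. foldr red_cons u v),
     one = []\<rparr>"

lemma inv_letter_inv_letter [simp]: "inv_letter (inv_letter a) = a"
  by (simp add: inv_letter_def)

lemma fst_inv_letter [simp]: "fst (inv_letter a) = fst a"
  by (simp add: inv_letter_def)

lemma reduced_Nil [simp]: "reduced []"
  by (simp add: reduced_def)

lemma reduced_ConsD: "reduced (a # u) \<Longrightarrow> reduced u"
  by (cases u) (auto simp: reduced_def)

lemma reduced_red_cons: "reduced u \<Longrightarrow> reduced (red_cons a u)"
  by (cases u) (auto simp: reduced_def dest: reduced_ConsD[unfolded reduced_def])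

lemma red_cons_reduced: "reduced (a # u) \<Longrightarrow> red_cons a u = a # u"
  by (cases u) (auto simp: reduced_def)

lemma red_cons_cancel: "reduced u \<Longrightarrow> red_cons a (red_cons (inv_letter a) u) = u"
  by (cases u) (auto simp: red_cons_reduced)

lemma reduced_foldr: "reduced v \<Longrightarrow> reduced (foldr red_cons u v)"
  by (induction u) (auto simp: reduced_red_cons)

lemma set_red_cons: "set (red_cons a u) \<subseteq> insert a (set u)"
  by (cases u) auto

lemma set_foldr_red_cons: "set (foldr red_cons u v) \<subseteq> set u \<union> set v"
  using set_red_cons by (induction u) (simp, fastforce)

lemma letters_foldr_red_cons:
  assumes "fst ` set u \<subseteq> X" "fst ` set v \<subseteq> X"
  shows "fst ` set (foldr red_cons u v) \<subseteq> X"
proof -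
  have "fst ` set (foldr red_cons u v) \<subseteq> fst ` (set u \<union> set v)"
    by (rule image_mono[OF set_foldr_red_cons])
  also have "\<dots> \<subseteq> X"
    using assms by blast
  finally show ?thesis .
qed

lemma foldr_red_cons:
  assumes "reduced w"
  shows "foldr red_cons (red_cons a u) w = red_cons a (foldr red_cons u w)"
proof (cases u)
  case (Cons b v)
  then show ?thesis
    using red_cons_cancel[OF reduced_foldr[OF assms], of a v] by auto
qed simp

lemma foldr_red_cons_assoc:
  "reduced w \<Longrightarrow>
    foldr red_cons (foldr red_cons u v) w = foldr red_cons u (foldr red_cons v w)"
  by (induction u) (simp_all add: foldr_red_cons)

lemma foldr_red_cons_inverse:
  "reduced u \<Longrightarrow> foldr red_cons (rev (map inv_letter u)) u = []"
proof (induction u)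
  case (Cons a u)
  then show ?case
    by (simp add: reduced_ConsD)
qed simp

lemma reduced_inverse: "reduced u \<Longrightarrow> reduced (rev (map inv_letter u))"
  unfolding reduced_def by (auto simp: successively_map elim: successively_mono)

lemma group_free_group: "group (free_group X)"
proof (rule groupI)
  fix u v assume u: "u \<in> carrier (free_group X)" and v: "v \<in> carrier (free_group X)"
  then show "u \<otimes>\<^bsub>free_group X\<^esub> v \<in> carrier (free_group X)"
    by (simp add: free_group_def reduced_foldr letters_foldr_red_cons)
next
  fix u assume u: "u \<in> carrier (free_group X)"
  have "rev (map inv_letter u) \<in> carrier (free_group X)"
    using u by (auto simp: free_group_def reduced_inverse)
  then show "\<exists>v\<in>carrier (free_group X). v \<otimes>\<^bsub>free_group X\<^esub> u = \<one>\<^bsub>free_group X\<^esub>"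
    using u foldr_red_cons_inverse
    by (intro bexI[of _ "rev (map inv_letter u)"]) (auto simp: free_group_def)
qed (auto simp: free_group_def foldr_red_cons_assoc)


section \<open>Words, iterated identities and iterational depth\<close>

text \<open>
  The elements of the free group of rank \<open>n\<close> are the elements of \<open>free_group {..<n}\<close>; the
  variables are numbered from \<open>0\<close>, so that the first variable has index \<open>0\<close>.
\<close>

definition word_eval :: "('a, 'm) monoid_scheme \<Rightarrow> ('x \<Rightarrow> 'a) \<Rightarrow> ('x \<times> bool) list \<Rightarrow> 'a"
  where "word_eval G x u =
    foldr (\<lambda>(i, e) y. (if e then x i else inv\<^bsub>G\<^esub> (x i)) \<otimes>\<^bsub>G\<^esub> y) u \<one>\<^bsub>G\<^esub>"

lemma (in group) word_eval_closed:
  assumes "x \<in> X \<rightarrow> carrier G" "fst ` set u \<subseteq> X"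
  shows "word_eval G x u \<in> carrier G"
  using assms(2)
proof (induction u)
  case (Cons a u)
  with assms(1) have "x (fst a) \<in> carrier G" by auto
  with Cons show ?case by (auto simp: word_eval_def split: prod.split)
qed (simp add: word_eval_def)

lemma (in group) word_eval_red_cons:
  assumes x: "x \<in> X \<rightarrow> carrier G" and "fst a \<in> X" "fst ` set u \<subseteq> X"
  shows "word_eval G x (red_cons a u) = word_eval G x (a # u)"
proof (cases u)
  case (Cons b v)
  show ?thesis
  proof (cases "b = inv_letter a")
    case True
    have "word_eval G x v \<in> carrier G" "x (fst a) \<in> carrier G"
      using assms Cons by (auto intro!: word_eval_closed[OF x])
    with True Cons show ?thesis
      by (cases a) (auto simp: word_eval_def inv_letter_def inv_solve_left m_assoc[symmetric])
  qed (simp add: Cons)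
qed simp

text \<open>Evaluation is the homomorphism given by the universal property of the free group.\<close>

lemma (in group) word_eval_hom:
  assumes x: "x \<in> X \<rightarrow> carrier G"
  shows "word_eval G x \<in> hom (free_group X) G"
proof -
  have "word_eval G x (foldr red_cons u v) = word_eval G x u \<otimes> word_eval G x v"
    if "fst ` set u \<subseteq> X" "fst ` set v \<subseteq> X" for u v
    using that
  proof (induction u)
    case Nil
    then show ?case using word_eval_closed[OF x Nil(2)] by (simp add: word_eval_def)
  next
    case (Cons a u)
    have "word_eval G x (foldr red_cons (a # u) v) = word_eval G x (a # foldr red_cons u v)"
      using Cons.prems by (simp add: word_eval_red_cons[OF x] letters_foldr_red_cons)
    moreover have "word_eval G x u \<in> carrier G" "word_eval G x v \<in> carrier G"
      "x (fst a) \<in> carrier G"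
      using Cons.prems x by (auto intro!: word_eval_closed[OF x])
    ultimately show ?case
      using Cons by (cases a) (auto simp: word_eval_def m_assoc)
  qed
  then show ?thesis
    by (auto simp: hom_def free_group_def intro!: word_eval_closed[OF x])
qed

text \<open>
  \<open>engel_iter n w N\<close> is the iterate of the word \<open>w\<close> on the first variable, as an element
  of the free group of rank \<open>n\<close>: substitution into \<open>w\<close> is evaluation in that group.
  Iterates are numbered from \<open>1\<close>; the value at \<open>0\<close> is never used below.
\<close>

fun engel_iter :: "nat \<Rightarrow> (nat \<times> bool) list \<Rightarrow> nat \<Rightarrow> (nat \<times> bool) list"
  where
    "engel_iter n w 0 = [(0, True)]"
  | "engel_iter n w (Suc 0) = w"
  | "engel_iter n w (Suc (Suc N)) =
      word_eval (free_group {..<n}) (\<lambda>i. if i = 0 then engel_iter n w (Suc N) else [(i, True)]) w"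

definition iterated_identity :: "('a, 'm) monoid_scheme \<Rightarrow> nat \<Rightarrow> (nat \<times> bool) list \<Rightarrow> bool"
  where "iterated_identity G n w \<longleftrightarrow>
    (\<forall>x \<in> {..<n} \<rightarrow> carrier G. \<exists>N\<ge>1. word_eval G x (engel_iter n w N) = \<one>\<^bsub>G\<^esub>)"

text \<open>In the extended reals, \<open>Inf {} = \<infinity>\<close> and \<open>Sup {} = -\<infinity>\<close>.\<close>

definition identity_depth :: "('a, 'm) monoid_scheme \<Rightarrow> nat \<Rightarrow> (nat \<times> bool) list \<Rightarrow> ereal"
  where "identity_depth G n w =
    Inf {ereal (real D) | D. D \<ge> 1 \<and>
      (\<forall>x \<in> {..<n} \<rightarrow> carrier G. \<exists>d\<in>{1..D}. word_eval G x (engel_iter n w d) = \<one>\<^bsub>G\<^esub>)}"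

definition iterational_depth :: "('a, 'm) monoid_scheme \<Rightarrow> ereal"
  where "iterational_depth G =
    Sup {identity_depth G n w | n w. n \<ge> 1 \<and> w \<in> carrier (free_group {..<n}) \<and>
      w \<noteq> \<one>\<^bsub>free_group {..<n}\<^esub> \<and> iterated_identity G n w}"


section \<open>The wreath product of the integers with the integers\<close>

definition semidirect_product ::
    "('a, 'm) monoid_scheme \<Rightarrow> ('b, 'k) monoid_scheme \<Rightarrow> ('b \<Rightarrow> 'a \<Rightarrow> 'a) \<Rightarrow> ('a \<times> 'b) monoid"
  where "semidirect_product A H \<phi> =
    \<lparr>carrier = carrier A \<times> carrier H,
     monoid.mult = (\<lambda>(a, s) (b, t). (a \<otimes>\<^bsub>A\<^esub> \<phi> s b, s \<otimes>\<^bsub>H\<^esub> t)),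
     one = (\<one>\<^bsub>A\<^esub>, \<one>\<^bsub>H\<^esub>)\<rparr>"

lemma group_semidirect_product:
  assumes "group A" "group H"
    and hom: "\<And>s. s \<in> carrier H \<Longrightarrow> \<phi> s \<in> hom A A"
    and one: "\<And>a. a \<in> carrier A \<Longrightarrow> \<phi> \<one>\<^bsub>H\<^esub> a = a"
    and mult: "\<And>s t a. s \<in> carrier H \<Longrightarrow> t \<in> carrier H \<Longrightarrow> a \<in> carrier A \<Longrightarrow>
      \<phi> (s \<otimes>\<^bsub>H\<^esub> t) a = \<phi> s (\<phi> t a)"
  shows "group (semidirect_product A H \<phi>)"
proof -
  interpret A: group A by fact
  interpret H: group H by fact
  have closed: "\<phi> s a \<in> carrier A" if "s \<in> carrier H" "a \<in> carrier A" for s a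
    using hom[OF that(1)] that(2) by (auto simp: hom_def)
  have dist: "\<phi> s (a \<otimes>\<^bsub>A\<^esub> b) = \<phi> s a \<otimes>\<^bsub>A\<^esub> \<phi> s b"
    if "s \<in> carrier H" "a \<in> carrier A" "b \<in> carrier A" for s a b
    using hom[OF that(1)] that(2,3) by (auto simp: hom_def)
  show ?thesis
  proof (rule groupI)
    fix p assume "p \<in> carrier (semidirect_product A H \<phi>)"
    then obtain a s where p: "p = (a, s)" "a \<in> carrier A" "s \<in> carrier H"
      by (auto simp: semidirect_product_def)
    have "\<phi> (inv\<^bsub>H\<^esub> s) (inv\<^bsub>A\<^esub> a) \<otimes>\<^bsub>A\<^esub> \<phi> (inv\<^bsub>H\<^esub> s) a = \<phi> (inv\<^bsub>H\<^esub> s) \<one>\<^bsub>A\<^esub>"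
      using p dist[of "inv\<^bsub>H\<^esub> s" "inv\<^bsub>A\<^esub> a" a] by simp
    moreover have "\<phi> (inv\<^bsub>H\<^esub> s) \<one>\<^bsub>A\<^esub> = \<one>\<^bsub>A\<^esub>"
      using hom_one[OF hom[of "inv\<^bsub>H\<^esub> s"]] p assms(1) by simp
    ultimately show "\<exists>q\<in>carrier (semidirect_product A H \<phi>).
        q \<otimes>\<^bsub>semidirect_product A H \<phi>\<^esub> p = \<one>\<^bsub>semidirect_product A H \<phi>\<^esub>"
      using p closed
      by (intro bexI[of _ "(\<phi> (inv\<^bsub>H\<^esub> s) (inv\<^bsub>A\<^esub> a), inv\<^bsub>H\<^esub> s)"])
        (auto simp: semidirect_product_def)
  qed (auto simp: semidirect_product_def closed dist one mult A.m_assoc H.m_assoc)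
qed

definition shift :: "int \<Rightarrow> (int \<Rightarrow> int) \<Rightarrow> int \<Rightarrow> int"
  where "shift t f = (\<lambda>i. f (i - t))"

definition wreath_int_int :: "((int \<Rightarrow> int) \<times> int) monoid"
  where "wreath_int_int =
    semidirect_product (sum_group UNIV (\<lambda>_. integer_group)) integer_group shift"

lemma carrier_wreath_int_int:
  "carrier wreath_int_int = {f. finite {i. f i \<noteq> 0}} \<times> UNIV"
  by (auto simp: wreath_int_int_def semidirect_product_def carrier_sum_group)

lemma group_wreath_int_int: "group wreath_int_int"
  unfolding wreath_int_int_def
proof (rule group_semidirect_product)
  fix s :: int
  have "finite {i. f (i - s) \<noteq> 0}" if "finite {i. f i \<noteq> 0}" for f :: "int \<Rightarrow> int"
  proof -
    have "{i. f (i - s) \<noteq> 0} = (\<lambda>i. i + s) ` {i. f i \<noteq> 0}"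
      by (auto simp: image_iff) (metis diff_add_cancel)
    then show ?thesis using that by simp
  qed
  then show "shift s \<in> hom (sum_group UNIV (\<lambda>_. integer_group)) (sum_group UNIV (\<lambda>_. integer_group))"
    by (auto simp: hom_def carrier_sum_group shift_def)
qed (auto simp: shift_def diff_diff_eq algebra_simps)

end

theory Submission
  imports Defs
begin

text \<open>
  If \<open>w\<close> is an iterated identity of \<open>\<int> \<wr> \<int>\<close>, then passing to the quotient \<open>\<int>\<close> shows that all
  exponent sums of \<open>w\<close> vanish, so \<open>w\<close> takes values in the base group. For fixed \<open>x\<^sub>2, \<dots>, x\<^sub>n\<close>, the
  map \<open>b \<mapsto> w(b, x\<^sub>2, \<dots>, x\<^sub>n)\<close> on the base group \<open>\<int>[t, t\<^sup>-\<^sup>1]\<close> is affine, \<open>b \<mapsto> D b + C\<close>, where the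
  Laurent polynomial \<open>D\<close> depends only on the images of the \<open>x\<^sub>i\<close> in \<open>\<int>\<close>, and \<open>C = 0\<close> if the base
  components of \<open>x\<^sub>2, \<dots>, x\<^sub>n\<close> are zero. In that case the iterates of \<open>1\<close> are the powers of \<open>D\<close>;
  one of them vanishes, hence \<open>D = 0\<close>. Then all iterates equal \<open>C\<close>, hence \<open>C = 0\<close>, and the second
  iterate of \<open>w\<close> is trivial. The word \<open>[x\<^sub>1, [x\<^sub>2, x\<^sub>3]]\<close> has depth exactly 2.
\<close>

section \<open>Iteration as iteration of a map\<close>

lemma word_eval_Nil: "word_eval G x [] = \<one>\<^bsub>G\<^esub>"
  by (simp add: word_eval_def)

lemma word_eval_Cons:
  "word_eval G x ((i, e) # u) = (if e then x i else inv\<^bsub>G\<^esub> (x i)) \<otimes>\<^bsub>G\<^esub> word_eval G x u"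
  by (simp add: word_eval_def)

lemma word_eval_cong:
  assumes "\<And>i. i \<in> fst ` set u \<Longrightarrow> x i = y i"
  shows "word_eval G x u = word_eval G y u"
  using assms by (induction u) (auto simp: word_eval_def split: prod.split)

text \<open>Evaluation at \<open>x\<close> is a homomorphism on the free group, so it passes through
  the substitution letter by letter.\<close>

lemma (in group) word_eval_subst:
  assumes x: "x \<in> X \<rightarrow> carrier G" and y: "y \<in> X \<rightarrow> carrier (free_group X)"
    and u: "fst ` set u \<subseteq> X"
  shows "word_eval G x (word_eval (free_group X) y u) = word_eval G (\<lambda>i. word_eval G x (y i)) u"
proof -
  interpret F: group "free_group X" by (rule group_free_group)
  interpret h: group_hom "free_group X" G "word_eval G x"
    using word_eval_hom[OF x] by unfold_locales
  show ?thesis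
    using u
  proof (induction u)
    case Nil
    then show ?case using h.hom_one by (simp add: word_eval_Nil)
  next
    case (Cons p u)
    obtain i e where p: "p = (i, e)" by (cases p)
    have "y i \<in> carrier (free_group X)" "word_eval (free_group X) y u \<in> carrier (free_group X)"
      using Cons.prems p y by (auto intro!: F.word_eval_closed[OF y])
    with Cons p show ?case
      by (auto simp: word_eval_Cons)
  qed
qed

lemma (in group) word_eval_upd_closed:
  assumes "w \<in> carrier (free_group X)" "x \<in> X \<rightarrow> carrier G" "y \<in> carrier G"
  shows "word_eval G (x(j := y)) w \<in> carrier G"
  by (rule word_eval_closed[where X = X]) (use assms in \<open>auto simp: free_group_def\<close>)

lemma engel_iter_closed:
  assumes "n \<ge> 1" "w \<in> carrier (free_group {..<n})"
  shows "engel_iter n w N \<in> carrier (free_group {..<n})"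
  using assms
proof (induction n w N rule: engel_iter.induct)
  case (3 n w N)
  interpret F: group "free_group {..<n}" by (rule group_free_group)
  show ?case
    unfolding engel_iter.simps
    by (rule F.word_eval_closed[where X = "{..<n}"])
      (use 3 in \<open>auto simp: free_group_def reduced_def\<close>)
qed (auto simp: free_group_def reduced_def)

text \<open>By \<open>word_eval_subst\<close>, substituting into the first variable becomes
  composing the map that evaluates \<open>w\<close> with \<open>x\<close> fixed outside 0.\<close>

lemma (in group) word_eval_engel_iter:
  assumes "n \<ge> 1" and w: "w \<in> carrier (free_group {..<n})" and x: "x \<in> {..<n} \<rightarrow> carrier G"
    and "N \<ge> 1"
  shows "word_eval G x (engel_iter n w N) = ((\<lambda>y. word_eval G (x(0 := y)) w) ^^ N) (x 0)"
  using \<open>N \<ge> 1\<close>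
proof (induction N rule: nat_induct_at_least)
  case base
  then show ?case by (simp del: fun_upd_apply)
next
  case (Suc N)
  then obtain M where N: "N = Suc M" by (cases N) auto
  let ?y = "\<lambda>i. if i = 0 then engel_iter n w (Suc M) else [(i, True)]"
  have sub: "fst ` set w \<subseteq> {..<n}"
    using w by (simp add: free_group_def)
  have y: "?y \<in> {..<n} \<rightarrow> carrier (free_group {..<n})"
    using engel_iter_closed[OF assms(1) w] by (auto simp: free_group_def reduced_def)
  have "word_eval G x (engel_iter n w (Suc N)) = word_eval G (\<lambda>i. word_eval G x (?y i)) w"
    using word_eval_subst[OF x y sub] N by simp
  also have "\<dots> = word_eval G (x(0 := word_eval G x (engel_iter n w N))) w"
  proof (rule word_eval_cong)
    fix i assume "i \<in> fst ` set w"
    then have "x i \<in> carrier G" using sub x by auto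
    then show "word_eval G x (?y i) = (x(0 := word_eval G x (engel_iter n w N))) i"
      using N by (simp add: word_eval_def)
  qed
  finally show ?case using Suc.IH by (simp del: fun_upd_apply)
qed

text \<open>The iterated map does not see the old value of \<open>x\<close> at 0, so the identity
  applies to any starting point.\<close>

lemma (in group) iterated_identity_orbit:
  assumes n: "n \<ge> 1" and w: "w \<in> carrier (free_group {..<n})"
    and id: "iterated_identity G n w" and x: "x \<in> {..<n} \<rightarrow> carrier G" and y: "y \<in> carrier G"
  obtains N where "N \<ge> 1" "((\<lambda>z. word_eval G (x(0 := z)) w) ^^ N) y = \<one>"
proof -
  have x': "x(0 := y) \<in> {..<n} \<rightarrow> carrier G"
    using x y by auto
  then obtain N where "N \<ge> 1" "word_eval G (x(0 := y)) (engel_iter n w N) = \<one>"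
    using id unfolding iterated_identity_def by blast
  with word_eval_engel_iter[OF n w x'] show thesis
    by (intro that[of N]) (simp_all only: fun_upd_upd fun_upd_same)
qed

section \<open>Evaluation in the wreath product\<close>

lemma mult_wreath_int_int:
  "(a, s) \<otimes>\<^bsub>wreath_int_int\<^esub> (b, t) = (\<lambda>k. a k + b (k - s), s + t)"
  by (simp add: wreath_int_int_def semidirect_product_def sum_group_def shift_def restrict_def)

lemma one_wreath_int_int: "\<one>\<^bsub>wreath_int_int\<^esub> = (\<lambda>_. 0, 0)"
  by (simp add: wreath_int_int_def semidirect_product_def sum_group_def restrict_def)

lemma finite_support_shift:
  fixes a :: "int \<Rightarrow> int"
  assumes "finite {k. a k \<noteq> 0}"
  shows "finite {k. a (k + s) \<noteq> 0}"
proof -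
  have "{k. a (k + s) \<noteq> 0} = (\<lambda>k. k - s) ` {k. a k \<noteq> 0}"
    by (auto simp: image_iff) (metis add_diff_cancel_right')
  with assms show ?thesis by simp
qed

lemma inv_wreath_int_int:
  assumes "finite {k. a k \<noteq> 0}"
  shows "inv\<^bsub>wreath_int_int\<^esub> (a, s) = (\<lambda>k. - a (k + s), - s)"
proof -
  interpret group wreath_int_int by (rule group_wreath_int_int)
  show ?thesis
    by (rule inv_equality)
      (use assms finite_support_shift[OF assms] in
        \<open>auto simp: mult_wreath_int_int one_wreath_int_int carrier_wreath_int_int\<close>)
qed

fun exponent_sum :: "('x \<Rightarrow> int) \<Rightarrow> ('x \<times> bool) list \<Rightarrow> int"
  where
    "exponent_sum s [] = 0"
  | "exponent_sum s ((i, e) # u) = (if e then s i else - s i) + exponent_sum s u"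

text \<open>
  In terms of Fox derivatives, \<open>fox_sum a s u\<close> is \<open>\<Sum>\<^sub>i (\<partial>u/\<partial>x\<^sub>i) a\<^sub>i\<close>, where the derivatives are
  evaluated at \<open>x\<^sub>j = t\<close> to the power \<open>s\<^sub>j\<close>.
\<close>

fun fox_sum :: "('x \<Rightarrow> int \<Rightarrow> int) \<Rightarrow> ('x \<Rightarrow> int) \<Rightarrow> ('x \<times> bool) list \<Rightarrow> int \<Rightarrow> int"
  where
    "fox_sum a s [] k = 0"
  | "fox_sum a s ((i, e) # u) k =
      (if e then a i k + fox_sum a s u (k - s i) else fox_sum a s u (k + s i) - a i (k + s i))"

text \<open>The inverse of \<open>(a, s)\<close> moves \<open>a\<close> by \<open>- s\<close>; hence
  the argument \<open>k + s i\<close> in the clause of \<open>fox_sum\<close> for inverse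
  letters.\<close>

lemma word_eval_wreath_int_int:
  assumes "x \<in> X \<rightarrow> carrier wreath_int_int" "fst ` set u \<subseteq> X"
  shows "word_eval wreath_int_int x u =
    (fox_sum (fst \<circ> x) (snd \<circ> x) u, exponent_sum (snd \<circ> x) u)"
  using assms(2)
proof (induction u)
  case (Cons p u)
  obtain i e where p: "p = (i, e)" by (cases p)
  obtain a s where xi: "x i = (a, s)" by (cases "x i")
  have "finite {k. a k \<noteq> 0}"
    using assms(1) Cons.prems p xi by (force simp: carrier_wreath_int_int)
  with Cons p xi show ?case
    by (auto simp: word_eval_def mult_wreath_int_int inv_wreath_int_int fun_eq_iff)
qed (simp add: word_eval_def one_wreath_int_int fun_eq_iff)

section \<open>Linearity of exponent sums and Fox sums\<close>

lemma exponent_sum_add: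
  "exponent_sum (\<lambda>i. s i + t i) u = exponent_sum s u + exponent_sum t u"
  by (induction u) auto

lemma exponent_sum_single:
  "exponent_sum (\<lambda>i. if i = j then c else 0) u = c * exponent_sum (\<lambda>i. if i = j then 1 else 0) u"
  by (induction u) (auto simp: algebra_simps)

lemma exponent_sum_upd:
  "exponent_sum (s(j := c)) u =
    c * exponent_sum (\<lambda>i. if i = j then 1 else 0) u + exponent_sum (s(j := 0)) u"
proof -
  have "s(j := c) = (\<lambda>i. (if i = j then c else 0) + (s(j := 0)) i)" by auto
  then show ?thesis
    using exponent_sum_single[of j c u] by (simp only: exponent_sum_add)
qed

lemma fox_sum_add:
  "fox_sum (\<lambda>i k. a i k + b i k) s u k = fox_sum a s u k + fox_sum b s u k"
  by (induction u arbitrary: k) auto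

abbreviation single_coord :: "'x \<Rightarrow> (int \<Rightarrow> int) \<Rightarrow> 'x \<Rightarrow> int \<Rightarrow> int"
  where "single_coord j b \<equiv> (\<lambda>_ _. 0)(j := b)"

text \<open>The Laurent polynomial 1. Put in coordinate \<open>j\<close>, it makes
  \<open>fox_sum\<close> the Fox derivative for \<open>j\<close>.\<close>

abbreviation unit_at_zero :: "int \<Rightarrow> int"
  where "unit_at_zero \<equiv> (\<lambda>k. if k = 0 then 1 else 0)"

text \<open>Linearity in \<open>a\<close> makes evaluation affine in a single base
  component.\<close>

lemma fox_sum_upd:
  "fox_sum (a(j := b)) s u k =
    fox_sum (single_coord j b) s u k + fox_sum (a(j := \<lambda>_. 0)) s u k"
proof -
  have "a(j := b) = (\<lambda>i k. single_coord j b i k + (a(j := \<lambda>_. 0)) i k)"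
    by (auto simp: fun_eq_iff)
  then show ?thesis
    by (simp only: fox_sum_add)
qed

text \<open>Letters act by shifts and signs, which commute with convolution, so the Fox sum is
  \<open>b\<close> times the Fox derivative for \<open>j\<close>.\<close>

lemma fox_sum_convolution:
  assumes "finite S" "\<And>k. k \<notin> S \<Longrightarrow> b k = 0"
  shows "fox_sum (single_coord j b) s u k =
    (\<Sum>l\<in>S. b l * fox_sum (single_coord j unit_at_zero) s u (k - l))"
proof (induction u arbitrary: k)
  case (Cons p u)
  obtain i e where p: "p = (i, e)" by (cases p)
  \<comment> \<open>\<open>unit_at_zero\<close> is neutral for convolution; this handles occurrences
    of the letter \<open>j\<close> itself.\<close>
  have b: "(\<Sum>l\<in>S. b l * unit_at_zero (k - l)) = b k" for k
  proof -
    have "(\<Sum>l\<in>S. b l * unit_at_zero (k - l)) = (\<Sum>l\<in>S. if k = l then b l else 0)"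
      by (intro sum.cong) auto
    then show ?thesis using assms by (simp add: sum.delta)
  qed
  show ?case
    using b[of k] b[of "k + s j"] p Cons.IH
    by (simp add: distrib_left right_diff_distrib sum.distrib sum_subtractf
        diff_right_commute diff_add_eq)
qed simp

text \<open>The group ring of the integers has no zero divisors, by comparison of top coefficients.\<close>

lemma convolution_nonzero:
  fixes b d :: "int \<Rightarrow> int"
  assumes "finite {k. b k \<noteq> 0}" "b \<noteq> (\<lambda>_. 0)" "finite {k. d k \<noteq> 0}" "d \<noteq> (\<lambda>_. 0)"
  obtains k where "(\<Sum>l | b l \<noteq> 0. b l * d (k - l)) \<noteq> 0"
proof -
  define q where "q = Max {k. b k \<noteq> 0}"
  define p where "p = Max {k. d k \<noteq> 0}"
  have q: "b q \<noteq> 0" "\<And>l. b l \<noteq> 0 \<Longrightarrow> l \<le> q"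
    using Max_in[OF assms(1)] Max_ge[OF assms(1)] assms(2) unfolding q_def by auto
  have p: "d p \<noteq> 0" "\<And>l. d l \<noteq> 0 \<Longrightarrow> l \<le> p"
    using Max_in[OF assms(3)] Max_ge[OF assms(3)] assms(4) unfolding p_def by auto
  have "(\<Sum>l | b l \<noteq> 0. b l * d (p + q - l)) = (\<Sum>l | b l \<noteq> 0. if l = q then b q * d p else 0)"
  proof (rule sum.cong)
    fix l assume "l \<in> {l. b l \<noteq> 0}"
    then have "l \<le> q" using q by auto
    then show "b l * d (p + q - l) = (if l = q then b q * d p else 0)"
      using p(2)[of "p + q - l"] by auto
  qed simp
  also have "\<dots> = b q * d p"
    using assms(1) q(1) by (simp add: sum.delta')
  finally show thesis
    using p(1) q(1) by (intro that[of "p + q"]) auto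
qed

section \<open>Iterated identities of the wreath product\<close>

lemma word_eval_wreath_int_int_upd:
  assumes "w \<in> carrier (free_group {..<n})" "x \<in> {..<n} \<rightarrow> carrier wreath_int_int"
    "y \<in> carrier wreath_int_int"
  shows "word_eval wreath_int_int (x(0 := y)) w =
    (fox_sum ((fst \<circ> x)(0 := fst y)) ((snd \<circ> x)(0 := snd y)) w,
     exponent_sum ((snd \<circ> x)(0 := snd y)) w)"
proof -
  have "x(0 := y) \<in> {..<n} \<rightarrow> carrier wreath_int_int"
    using assms by auto
  then show ?thesis
    using assms(1) word_eval_wreath_int_int[of "x(0 := y)" "{..<n}" w]
    by (simp add: free_group_def fun_upd_comp)
qed

text \<open>Projected to the acting integers, \<open>w\<close> becomes an affine map whose orbits
  must reach 0. Its slope and its constant vanish in turn.\<close>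

lemma exponent_sum_iterated_identity:
  assumes n: "n \<ge> 1" and w: "w \<in> carrier (free_group {..<n})"
    and id: "iterated_identity wreath_int_int n w"
  shows "exponent_sum s w = 0"
proof -
  interpret group wreath_int_int by (rule group_wreath_int_int)
  define e where "e = exponent_sum (\<lambda>i. if i = 0 then 1 else 0) w"
  have ex: "\<exists>N\<ge>1. ((\<lambda>c. c * e + exponent_sum (s(0 := 0)) w) ^^ N) (s 0) = 0" for s
  proof -
    let ?x = "\<lambda>i. (\<lambda>_. 0, s i)"
    let ?f = "\<lambda>y. word_eval wreath_int_int (?x(0 := y)) w"
    have x: "?x \<in> {..<n} \<rightarrow> carrier wreath_int_int"
      by (auto simp: carrier_wreath_int_int)
    have "(?f ^^ N) (?x 0) \<in> carrier wreath_int_int \<and>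
        snd ((?f ^^ N) (?x 0)) = ((\<lambda>c. c * e + exponent_sum (s(0 := 0)) w) ^^ N) (s 0)" for N
    proof (induction N)
      case 0
      then show ?case by (auto simp: carrier_wreath_int_int)
    next
      case (Suc N)
      let ?y = "(?f ^^ N) (?x 0)"
      have "?f ?y \<in> carrier wreath_int_int"
        using word_eval_upd_closed[OF w x] Suc by blast
      moreover have "snd (?f ?y) = exponent_sum (s(0 := snd ?y)) w"
        using word_eval_wreath_int_int_upd[OF w x, of ?y] Suc by (simp add: comp_def del: fun_upd_apply)
      ultimately show ?case
        using Suc exponent_sum_upd[of s 0 "snd ?y" w] by (simp add: e_def del: fun_upd_apply)
    qed
    moreover have "?x 0 \<in> carrier wreath_int_int"
      by (simp add: carrier_wreath_int_int)
    from iterated_identity_orbit[OF n w id x this]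
    obtain N where "N \<ge> 1" "(?f ^^ N) (?x 0) = \<one>\<^bsub>wreath_int_int\<^esub>" .
    ultimately show ?thesis
      by (metis one_wreath_int_int snd_conv)
  qed
  have "exponent_sum (\<lambda>i. if i = 0 then 0 else 0) w = 0"
    using exponent_sum_single[of 0 0 w] by simp
  then have zero: "exponent_sum ((\<lambda>i. if i = 0 then 1 else 0)(0 := 0)) w = 0"
    by (simp add: fun_upd_def cong: if_cong)
  \<comment> \<open>Starting at 1 with all other variables 0 gives powers of \<open>e\<close>, one
    of which must vanish.\<close>
  have "((\<lambda>c. c * e) ^^ N) 1 = e ^ N" for N
    by (induction N) auto
  then have e: "e = 0"
    using ex[of "\<lambda>i. if i = 0 then 1 else 0"] zero by auto
  have "((\<lambda>c. exponent_sum (s(0 := 0)) w) ^^ N) (s 0) = exponent_sum (s(0 := 0)) w"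
    if "N \<ge> 1" for N
    using that by (cases N) auto
  then have "exponent_sum (s(0 := 0)) w = 0"
    using ex[of s] e by auto
  then show ?thesis
    using exponent_sum_upd[of s 0 "s 0" w] e by (simp add: e_def)
qed

text \<open>The linear part is killed first, with base components set to zero; then the constant,
  for the given \<open>x\<close>.\<close>

lemma word_eval_iterated_identity:
  assumes n: "n \<ge> 1" and w: "w \<in> carrier (free_group {..<n})"
    and id: "iterated_identity wreath_int_int n w"
    and x: "x \<in> {..<n} \<rightarrow> carrier wreath_int_int" and b: "finite {k. b k \<noteq> 0}"
  shows "word_eval wreath_int_int (x(0 := (b, 0))) w = \<one>\<^bsub>wreath_int_int\<^esub>"
proof -
  interpret group wreath_int_int by (rule group_wreath_int_int)
  define s where "s = (snd \<circ> x)(0 := 0)"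
  define T where "T = (\<lambda>b. fox_sum (single_coord 0 b) s w)"
  have eval: "word_eval wreath_int_int (z(0 := (b, 0))) w =
      (\<lambda>k. T b k + fox_sum ((fst \<circ> z)(0 := \<lambda>_. 0)) s w k, 0)"
    if "z \<in> {..<n} \<rightarrow> carrier wreath_int_int" "(snd \<circ> z)(0 := 0) = s" "finite {k. b k \<noteq> 0}"
    for z b
    using word_eval_wreath_int_int_upd[OF w that(1), of "(b, 0)"] that
      exponent_sum_iterated_identity[OF n w id] fox_sum_upd[of "fst \<circ> z" 0 b s w]
    by (auto simp: T_def carrier_wreath_int_int fun_eq_iff)
  \<comment> \<open>\<open>T\<close> is multiplication by \<open>T unit_at_zero\<close>, the Fox
    derivative for the first variable.\<close>
  have conv: "T b k = (\<Sum>l | b l \<noteq> 0. b l * T unit_at_zero (k - l))"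
    if "finite {k. b k \<noteq> 0}" for b k
    unfolding T_def by (rule fox_sum_convolution[OF that]) auto
  \<comment> \<open>Same shifts, zero base components: \<open>T\<close> is unchanged and the affine
    constant vanishes.\<close>
  let ?z = "\<lambda>i. (\<lambda>_. 0, s i)"
  let ?f = "\<lambda>y. word_eval wreath_int_int (?z(0 := y)) w"
  have z: "?z \<in> {..<n} \<rightarrow> carrier wreath_int_int" "(snd \<circ> ?z)(0 := 0) = s"
    by (auto simp: carrier_wreath_int_int s_def fun_eq_iff)
  have fox_0: "fox_sum (\<lambda>_ _. 0) s w k = 0" for k
    by (induction w arbitrary: k) auto
  have fst_z: "(fst \<circ> ?z)(0 := \<lambda>_. 0) = (\<lambda>_ _. 0)"
    by (auto simp: fun_eq_iff)
  have f: "?f (b, 0) = (T b, 0)" if "finite {k. b k \<noteq> 0}" for b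
    using eval[OF z that] unfolding fst_z fox_0 by simp
  have fin: "finite {k. T b k \<noteq> 0}" if "finite {k. b k \<noteq> 0}" for b
  proof -
    have "?f (b, 0) \<in> carrier wreath_int_int"
      using word_eval_upd_closed[OF w z(1)] that by (simp add: carrier_wreath_int_int)
    then show ?thesis
      using f[OF that] by (simp add: carrier_wreath_int_int)
  qed
  have T1: "T unit_at_zero = (\<lambda>_. 0)"
  proof (rule ccontr)
    assume nz: "T unit_at_zero \<noteq> (\<lambda>_. 0)"
    have unit: "finite {k. unit_at_zero k \<noteq> 0}" by simp
    \<comment> \<open>The iterates of 1 are powers of \<open>T unit_at_zero\<close>, nonzero by
      \<open>convolution_nonzero\<close>.\<close>
    have "\<exists>c. (?f ^^ N) (unit_at_zero, 0) = (c, 0) \<and> finite {k. c k \<noteq> 0} \<and> c \<noteq> (\<lambda>_. 0)" for N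
    proof (induction N)
      case 0
      show ?case by (rule exI[of _ unit_at_zero]) (auto simp: fun_eq_iff)
    next
      case (Suc N)
      then obtain c where c: "(?f ^^ N) (unit_at_zero, 0) = (c, 0)" "finite {k. c k \<noteq> 0}"
        "c \<noteq> (\<lambda>_. 0)" by blast
      obtain k where "T c k \<noteq> 0"
        using convolution_nonzero[OF c(2,3) fin[OF unit] nz] conv[OF c(2)] by auto
      then have "T c \<noteq> (\<lambda>_. 0)" by auto
      then show ?case
        using c(1) f[OF c(2)] fin[OF c(2)]
        by (intro exI[of _ "T c"]) (simp del: fun_upd_apply)
    qed
    moreover obtain N where "(?f ^^ N) (unit_at_zero, 0) = \<one>\<^bsub>wreath_int_int\<^esub>"
      using iterated_identity_orbit[OF n w id z(1), of "(unit_at_zero, 0)"] unit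
      by (auto simp: carrier_wreath_int_int)
    ultimately show False
      unfolding one_wreath_int_int by (metis prod.inject)
  qed
  define C where "C = fox_sum ((fst \<circ> x)(0 := \<lambda>_. 0)) s w"
  let ?g = "\<lambda>y. word_eval wreath_int_int (x(0 := y)) w"
  have g: "?g (b, 0) = (C, 0)" if "finite {k. b k \<noteq> 0}" for b
    using eval[OF x s_def[symmetric] that] conv[OF that] T1 by (simp add: C_def)
  have "?g (b, 0) \<in> carrier wreath_int_int"
    using word_eval_upd_closed[OF w x] b by (simp add: carrier_wreath_int_int)
  then have "finite {k. C k \<noteq> 0}"
    using g[OF b] by (simp add: carrier_wreath_int_int)
  \<comment> \<open>One application lands on \<open>C\<close> for every \<open>b\<close>, so the
    orbit is constant from then on.\<close>
  then have "(?g ^^ Suc N) (b, 0) = (C, 0)" for N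
    by (induction N) (use g b in auto)
  then have *: "(?g ^^ N) (b, 0) = (C, 0)" if "N \<ge> 1" for N
    using that by (cases N) auto
  have "(b, 0) \<in> carrier wreath_int_int"
    using b by (simp add: carrier_wreath_int_int)
  then obtain N where "N \<ge> 1" "(?g ^^ N) (b, 0) = \<one>\<^bsub>wreath_int_int\<^esub>"
    by (rule iterated_identity_orbit[OF n w id x])
  with * g[OF b] show ?thesis by simp
qed

text \<open>The first application lands in the base group by \<open>exp\<close>, and the second is
  trivial by \<open>triv\<close>. Fixing a single \<open>x\<close> lets this serve both the upper
  bound and the explicit word.\<close>

lemma word_eval_engel_iter_2:
  assumes n: "n \<ge> 1" and w: "w \<in> carrier (free_group {..<n})"
    and x: "x \<in> {..<n} \<rightarrow> carrier wreath_int_int"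
    and exp: "exponent_sum (snd \<circ> x) w = 0"
    and triv: "\<And>b. finite {k. b k \<noteq> 0} \<Longrightarrow>
      word_eval wreath_int_int (x(0 := (b, 0))) w = \<one>\<^bsub>wreath_int_int\<^esub>"
  shows "word_eval wreath_int_int x (engel_iter n w 2) = \<one>\<^bsub>wreath_int_int\<^esub>"
proof -
  interpret group wreath_int_int by (rule group_wreath_int_int)
  have sub: "fst ` set w \<subseteq> {..<n}"
    using w by (simp add: free_group_def)
  obtain b where "word_eval wreath_int_int x w = (b, 0)"
    using word_eval_wreath_int_int[OF x sub] exp by simp
  moreover from this have "finite {k. b k \<noteq> 0}"
    using word_eval_closed[OF x sub] by (simp add: carrier_wreath_int_int)
  ultimately show ?thesis
    using word_eval_engel_iter[OF n w x, of 2] triv by (simp add: numeral_2_eq_2)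
qed

lemma identity_depth_wreath_int_int_le:
  assumes n: "n \<ge> 1" and w: "w \<in> carrier (free_group {..<n})"
    and id: "iterated_identity wreath_int_int n w"
  shows "identity_depth wreath_int_int n w \<le> 2"
proof -
  have "\<exists>d\<in>{1..2}. word_eval wreath_int_int x (engel_iter n w d) = \<one>\<^bsub>wreath_int_int\<^esub>"
    if "x \<in> {..<n} \<rightarrow> carrier wreath_int_int" for x
    using word_eval_engel_iter_2[OF n w that exponent_sum_iterated_identity[OF n w id]
        word_eval_iterated_identity[OF n w id that]]
    by (intro bexI[of _ 2]) auto
  then have "identity_depth wreath_int_int n w \<le> ereal (real 2)"
    unfolding identity_depth_def by (intro Inf_lower CollectI exI[of _ 2]) auto
  then show ?thesis by simp
qed

section \<open>A word of depth two\<close>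

text \<open>The reduced form of \<open>[x_1, [x_2, x_3]]\<close> with
  \<open>[a, b] = a b a^-1 b^-1\<close>, variables numbered from 0.\<close>

definition triple_commutator :: "(nat \<times> bool) list"
  where "triple_commutator =
    [(0, True), (1, True), (2, True), (1, False), (2, False),
     (0, False), (2, True), (1, True), (2, False), (1, False)]"

lemma triple_commutator_closed: "triple_commutator \<in> carrier (free_group {..<3})"
  by (auto simp: triple_commutator_def free_group_def reduced_def inv_letter_def)

text \<open>A first argument in the base group commutes with the inner commutator, which lies in
  that same abelian group.\<close>

lemma word_eval_engel_iter_triple_commutator:
  assumes x: "x \<in> {..<3} \<rightarrow> carrier wreath_int_int"
  shows "word_eval wreath_int_int x (engel_iter 3 triple_commutator 2) = \<one>\<^bsub>wreath_int_int\<^esub>"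
proof (rule word_eval_engel_iter_2[OF _ triple_commutator_closed x])
  show "exponent_sum (snd \<circ> x) triple_commutator = 0"
    by (simp add: triple_commutator_def)
  fix b :: "int \<Rightarrow> int" assume "finite {k. b k \<noteq> 0}"
  then have "(b, 0) \<in> carrier wreath_int_int" by (simp add: carrier_wreath_int_int)
  from word_eval_wreath_int_int_upd[OF triple_commutator_closed x this]
  show "word_eval wreath_int_int (x(0 := (b, 0))) triple_commutator = \<one>\<^bsub>wreath_int_int\<^esub>"
    by (simp add: triple_commutator_def one_wreath_int_int fun_eq_iff algebra_simps)
qed simp

lemma word_eval_triple_commutator_nontrivial:
  obtains x where "x \<in> {..<3} \<rightarrow> carrier wreath_int_int"
    "word_eval wreath_int_int x triple_commutator \<noteq> \<one>\<^bsub>wreath_int_int\<^esub>"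
proof -
  \<comment> \<open>The shift \<open>t\<close> twice and the base element 1: the word takes the
    value \<open>(t - 1)^2\<close>, with constant coefficient 1.\<close>
  let ?x = "\<lambda>i::nat. if i = 2 then (unit_at_zero, 0) else (\<lambda>_. 0, 1::int)"
  have x: "?x \<in> {..<3} \<rightarrow> carrier wreath_int_int"
    by (auto simp: carrier_wreath_int_int)
  have "fst ` set triple_commutator \<subseteq> {..<3}"
    using triple_commutator_closed by (simp add: free_group_def)
  from word_eval_wreath_int_int[OF x this]
  have "fst (word_eval wreath_int_int ?x triple_commutator) 0 = 1"
    by (simp add: triple_commutator_def)
  then have "word_eval wreath_int_int ?x triple_commutator \<noteq> \<one>\<^bsub>wreath_int_int\<^esub>"
    by (metis fst_conv one_wreath_int_int zero_neq_one)
  with x show thesis by (rule that)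
qed

lemma identity_depth_triple_commutator:
  "identity_depth wreath_int_int 3 triple_commutator \<ge> 2"
  unfolding identity_depth_def
proof (intro Inf_greatest, clarify)
  fix D :: nat
  assume D: "D \<ge> 1" "\<forall>x\<in>{..<3} \<rightarrow> carrier wreath_int_int. \<exists>d\<in>{1..D}.
    word_eval wreath_int_int x (engel_iter 3 triple_commutator d) = \<one>\<^bsub>wreath_int_int\<^esub>"
  \<comment> \<open>For \<open>D = 1\<close> the only iterate available is the word itself.\<close>
  have "D \<noteq> 1"
    using D(2) word_eval_triple_commutator_nontrivial by force
  with D(1) have "real 2 \<le> real D" by linarith
  then show "2 \<le> ereal (real D)"
    by (metis ereal_less_eq(3) of_nat_numeral numeral_eq_ereal)
qed

theorem proposition6p1:
  shows "iterational_depth wreath_int_int = 2"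
proof (rule antisym)
  show "iterational_depth wreath_int_int \<le> 2"
    unfolding iterational_depth_def
    using identity_depth_wreath_int_int_le by (intro Sup_least) blast
  have "iterated_identity wreath_int_int 3 triple_commutator"
    unfolding iterated_identity_def
    using word_eval_engel_iter_triple_commutator by (intro ballI exI[of _ 2]) auto
  then have "identity_depth wreath_int_int 3 triple_commutator \<le> iterational_depth wreath_int_int"
    unfolding iterational_depth_def using triple_commutator_closed
    by (intro Sup_upper CollectI exI[of _ 3] exI[of _ triple_commutator])
      (auto simp: free_group_def triple_commutator_def)
  with identity_depth_triple_commutator show "2 \<le> iterational_depth wreath_int_int"
    by (rule order_trans)
qed

end
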